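(* Let $(\mathcal{F}=\mathcal{F}^{+}\dot{+}\mathcal{F}^{-},[\cdot,\cdot],\mathcal{J})$ be a Krein space and $t\in\mathcal{F}$. If $f:[a,b]\to\mathcal{F}$ is strongly of bounded variation in $(\mathcal{F},[\cdot,\cdot])$, then $f$ is strongly of bounded $t$-variation in the standardized two-Krein space induced by $[\cdot,\cdot]$.
   Context: A Krein space is a pair $(\mathcal{F},[\cdot,\cdot])$ where $\mathcal{F}$ is a complex vector space and $[\cdot,\cdot]$ is an indefinite inner product (a Hermitian sesquilinear form, linear in the first variable) admitting a direct sum decomposition $\mathcal{F}=\mathcal{F}^{+}\dot{+}\mathcal{F}^{-}$ into mutually $[\cdot,\cdot]$-orthogonal subspaces (a fundamental decomposition) such that $(\mathcal{F}^{+},[\cdot,\cdot])$ and $(\mathcal{F}^{-},-[\cdot,\cdot])$ are Hilbert spaces. Each $x\in\mathcal{F}$ is written $x=x^{+}+x^{-}$ with $x^{\pm}\in\mathcal{F}^{\pm}$; the fundamental symmetry is $\mathcal{J}x=x^{+}-x^{-}$; $\|x^{+}\|_{+}=\sqrt{[x^{+},x^{+}]}$, $\|x^{-}\|_{-}=\sqrt{-[x^{-},x^{-}]}$. The standardized two-Krein space induced by $[\cdot,\cdot]$ is $\mathcal{F}$ equipped with $\psi(x,y,z)=[x^{+},y^{+}]\|z^{+}\|_{+}^{2}+[x^{-},y^{-}]\|z^{-}\|_{-}^{2}$. Its $\mathcal{J}$-two-norm is $\mathcal{N}_{\mathcal{J}}(x,y)=\sqrt{\psi(\mathcal{J}x,x,y)}$.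 Let $\mathcal{P}[a,b]$ be the set of finite partitions $a=x_0<x_1<\dots<x_n=b$ of the closed interval $[a,b]$, and write $f(x)=f^{+}(x)+f^{-}(x)$ with $f^{\pm}(x)\in\mathcal{F}^{\pm}$. The function $f$ is strongly of bounded variation in $(\mathcal{F},[\cdot,\cdot])$ if $\sup_{P\in\mathcal{P}[a,b]}\sum_{i=1}^{n}\big(\|f^{+}(x_i)-f^{+}(x_{i-1})\|_{+}+\|f^{-}(x_i)-f^{-}(x_{i-1})\|_{-}\big)<\infty$. It is strongly of bounded $t$-variation in the standardized two-Krein space if $V_{a}^{b}(f,\mathcal{F},t)_{\mathcal{J}}=\sup_{P\in\mathcal{P}[a,b]}\sum_{i=1}^{n}\mathcal{N}_{\mathcal{J}}(f(x_i)-f(x_{i-1}),t)<\infty$. *)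

theory Defs
  imports "HOL-Analysis.Analysis"
begin

text \<open>
  The type class hierarchy has no complex inner product spaces, so a complex vector space is
  the locale \<^locale>\<open>vector_space\<close> with scalar multiplication
  \<open>smul :: complex \<Rightarrow> 'a \<Rightarrow> 'a\<close>, and forms are functions \<open>'a \<Rightarrow> 'a \<Rightarrow> complex\<close>,
  linear in the first variable.
\<close>

definition hermitian_form_on ::
    "(complex \<Rightarrow> 'a::ab_group_add \<Rightarrow> 'a) \<Rightarrow> 'a set \<Rightarrow> ('a \<Rightarrow> 'a \<Rightarrow> complex) \<Rightarrow> bool" where
  "hermitian_form_on smul S ip \<longleftrightarrow>
     (\<forall>x\<in>S. \<forall>y\<in>S. \<forall>z\<in>S. ip (x + y) z = ip x z + ip y z) \<and>
     (\<forall>c. \<forall>x\<in>S. \<forall>y\<in>S. ip (smul c x) y = c * ip x y) \<and>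
     (\<forall>x\<in>S. \<forall>y\<in>S. ip y x = cnj (ip x y))"

text \<open>Diagonal values of a Hermitian form are real, so \<^const>\<open>Re\<close> loses nothing here.\<close>

definition form_norm :: "('a \<Rightarrow> 'a \<Rightarrow> complex) \<Rightarrow> 'a \<Rightarrow> real" where
  "form_norm ip x = sqrt (Re (ip x x))"

definition hilbert_on ::
    "(complex \<Rightarrow> 'a::ab_group_add \<Rightarrow> 'a) \<Rightarrow> 'a set \<Rightarrow> ('a \<Rightarrow> 'a \<Rightarrow> complex) \<Rightarrow> bool" where
  "hilbert_on smul S ip \<longleftrightarrow>
     module.subspace smul S \<and>
     hermitian_form_on smul S ip \<and>
     (\<forall>x\<in>S. x \<noteq> 0 \<longrightarrow> Re (ip x x) > 0) \<and>
     Metric_space.mcomplete S (\<lambda>x y. form_norm ip (x - y))"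

text \<open>
  A Krein space together with a chosen fundamental decomposition. The ambient space is the whole
  type \<open>'a\<close>. Either summand may be \<open>{0}\<close>: ``indefinite'' means ``not assumed definite''.
\<close>

locale krein_space = vector_space smul
  for smul :: "complex \<Rightarrow> 'a::ab_group_add \<Rightarrow> 'a" +
  fixes br :: "'a \<Rightarrow> 'a \<Rightarrow> complex"
    and Fp Fm :: "'a set"
  assumes hermitian: "hermitian_form_on smul UNIV br"
    and hilbert_pos: "hilbert_on smul Fp br"
    and hilbert_neg: "hilbert_on smul Fm (\<lambda>x y. - br x y)"
    and decomp_sum: "\<exists>u\<in>Fp. \<exists>v\<in>Fm. x = u + v"
    and decomp_direct: "Fp \<inter> Fm = {0}"
    and decomp_orth: "\<lbrakk>u \<in> Fp; v \<in> Fm\<rbrakk> \<Longrightarrow> br u v = 0"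

definition pos_part :: "'a::ab_group_add set \<Rightarrow> 'a set \<Rightarrow> 'a \<Rightarrow> 'a" where
  "pos_part Fp Fm x = (THE u. u \<in> Fp \<and> (\<exists>v\<in>Fm. x = u + v))"

definition neg_part :: "'a::ab_group_add set \<Rightarrow> 'a set \<Rightarrow> 'a \<Rightarrow> 'a" where
  "neg_part Fp Fm x = (THE v. v \<in> Fm \<and> (\<exists>u\<in>Fp. x = u + v))"

definition fund_sym :: "'a::ab_group_add set \<Rightarrow> 'a set \<Rightarrow> 'a \<Rightarrow> 'a" where
  "fund_sym Fp Fm x = pos_part Fp Fm x - neg_part Fp Fm x"

definition norm_pos :: "('a \<Rightarrow> 'a \<Rightarrow> complex) \<Rightarrow> 'a \<Rightarrow> real" where
  "norm_pos br = form_norm br"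

definition norm_neg :: "('a \<Rightarrow> 'a \<Rightarrow> complex) \<Rightarrow> 'a \<Rightarrow> real" where
  "norm_neg br = form_norm (\<lambda>x y. - br x y)"

text \<open>The form \<open>\<psi>\<close> of the standardized two-Krein space induced by \<open>br\<close>.\<close>

definition std_two_form ::
    "('a::ab_group_add \<Rightarrow> 'a \<Rightarrow> complex) \<Rightarrow> 'a set \<Rightarrow> 'a set \<Rightarrow> 'a \<Rightarrow> 'a \<Rightarrow> 'a \<Rightarrow> complex" where
  "std_two_form br Fp Fm x y z =
     br (pos_part Fp Fm x) (pos_part Fp Fm y) * of_real ((norm_pos br (pos_part Fp Fm z))\<^sup>2) +
     br (neg_part Fp Fm x) (neg_part Fp Fm y) * of_real ((norm_neg br (neg_part Fp Fm z))\<^sup>2)"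

text \<open>
  The radicand is real, see \<open>std_two_form_fund_sym_real\<close> below, so again \<^const>\<open>Re\<close> only
  changes the type.
\<close>

definition two_norm ::
    "('a::ab_group_add \<Rightarrow> 'a \<Rightarrow> complex) \<Rightarrow> 'a set \<Rightarrow> 'a set \<Rightarrow> 'a \<Rightarrow> 'a \<Rightarrow> real" where
  "two_norm br Fp Fm x y = sqrt (Re (std_two_form br Fp Fm (fund_sym Fp Fm x) x y))"

text \<open>
  A partition is a pair of the number \<open>n\<close> of subintervals and its points, of which only
  \<open>x 0, \<dots>, x n\<close> matter.
\<close>

definition partitions :: "real \<Rightarrow> real \<Rightarrow> (nat \<times> (nat \<Rightarrow> real)) set" where
  "partitions a b = {(n, x). x 0 = a \<and> x n = b \<and> (\<forall>i<n. x i < x (Suc i))}"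

definition strong_variation ::
    "('a::ab_group_add \<Rightarrow> 'a \<Rightarrow> complex) \<Rightarrow> 'a set \<Rightarrow> 'a set \<Rightarrow> real \<Rightarrow> real \<Rightarrow> (real \<Rightarrow> 'a) \<Rightarrow> ereal"
  where
  "strong_variation br Fp Fm a b f =
     (SUP (n, x) \<in> partitions a b. ereal (\<Sum>i=1..n.
        norm_pos br (pos_part Fp Fm (f (x i)) - pos_part Fp Fm (f (x (i - 1)))) +
        norm_neg br (neg_part Fp Fm (f (x i)) - neg_part Fp Fm (f (x (i - 1))))))"

definition strongly_bounded_variation ::
    "('a::ab_group_add \<Rightarrow> 'a \<Rightarrow> complex) \<Rightarrow> 'a set \<Rightarrow> 'a set \<Rightarrow> real \<Rightarrow> real \<Rightarrow> (real \<Rightarrow> 'a) \<Rightarrow> bool"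
  where
  "strongly_bounded_variation br Fp Fm a b f \<longleftrightarrow> strong_variation br Fp Fm a b f < \<infinity>"

definition strong_t_variation ::
    "('a::ab_group_add \<Rightarrow> 'a \<Rightarrow> complex) \<Rightarrow> 'a set \<Rightarrow> 'a set \<Rightarrow> 'a \<Rightarrow> real \<Rightarrow> real \<Rightarrow> (real \<Rightarrow> 'a) \<Rightarrow> ereal"
  where
  "strong_t_variation br Fp Fm t a b f =
     (SUP (n, x) \<in> partitions a b. ereal (\<Sum>i=1..n.
        two_norm br Fp Fm (f (x i) - f (x (i - 1))) t))"

definition strongly_bounded_t_variation ::
    "('a::ab_group_add \<Rightarrow> 'a \<Rightarrow> complex) \<Rightarrow> 'a set \<Rightarrow> 'a set \<Rightarrow> 'a \<Rightarrow> real \<Rightarrow> real \<Rightarrow> (real \<Rightarrow> 'a) \<Rightarrow> bool"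
  where
  "strongly_bounded_t_variation br Fp Fm t a b f \<longleftrightarrow> strong_t_variation br Fp Fm t a b f < \<infinity>"

context krein_space
begin

lemma subspace_Fp: "subspace Fp" and subspace_Fm: "subspace Fm"
  using hilbert_pos hilbert_neg by (auto simp: hilbert_on_def)

lemma decomp_unique:
  assumes "u \<in> Fp" "v \<in> Fm" "u' \<in> Fp" "v' \<in> Fm" "u + v = u' + v'"
  shows "u = u'" "v = v'"
proof -
  have eq: "u - u' = v' - v"
    using assms(5) by (metis add_diff_cancel add_diff_cancel_left' add_diff_eq diff_diff_eq2)
  have "u - u' \<in> Fp" "v' - v \<in> Fm"
    using assms subspace_Fp subspace_Fm by (auto intro: subspace_diff)
  then have "u - u' \<in> Fp \<inter> Fm" using eq by auto
  then show "u = u'" using decomp_direct by auto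
  then show "v = v'" using assms(5) by simp
qed

lemma parts_eqI:
  assumes "u \<in> Fp" "v \<in> Fm"
  shows "pos_part Fp Fm (u + v) = u" "neg_part Fp Fm (u + v) = v"
  unfolding pos_part_def neg_part_def
  using assms by (auto intro!: the_equality dest: decomp_unique)

lemma std_two_form_fund_sym_real: "Im (std_two_form br Fp Fm (fund_sym Fp Fm x) x y) = 0"
proof -
  have real: "Im (br z z) = 0" for z
    using hermitian unfolding hermitian_form_on_def
    by (metis UNIV_I Reals_cnj_iff complex_is_Real_iff)
  have neg: "br (- z) z = - br z z" for z
  proof -
    have "br (smul (-1) z) z = -1 * br z z"
      using hermitian unfolding hermitian_form_on_def by blast
    then show ?thesis by (simp add: scale_minus_left)
  qed
  obtain u v where uv: "u \<in> Fp" "v \<in> Fm" "x = u + v" using decomp_sum by blast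
  have J: "fund_sym Fp Fm x = u + (- v)"
    using uv by (simp add: fund_sym_def parts_eqI)
  have "- v \<in> Fm" using uv subspace_Fm by (auto intro: subspace_neg)
  then have parts: "pos_part Fp Fm (fund_sym Fp Fm x) = u" "neg_part Fp Fm (fund_sym Fp Fm x) = - v"
      "pos_part Fp Fm x = u" "neg_part Fp Fm x = v"
    unfolding J using uv parts_eqI by blast+
  show ?thesis
    by (simp add: std_two_form_def parts neg real)
qed

end

end

theory Submission
  imports Defs
begin

text \<open>
  For a vector \<open>x\<close> put \<open>p = \<parallel>x\<^sup>+\<parallel>\<close> and \<open>q = \<parallel>x\<^sup>-\<parallel>\<close>, and let \<open>P\<close> and \<open>Q\<close> be the same quantities
  for \<open>t\<close>. The fundamental symmetry turns the negative form on \<open>Fm\<close> into a positive one, so the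
  two-norm of \<open>x\<close> against \<open>t\<close> is the Euclidean length of the pair \<open>(p P, q Q)\<close>
  (\<open>two_norm_eq\<close>). This length is at most \<open>p P + q Q \<le> (P + Q) (p + q)\<close>, and \<open>P + Q\<close> does not
  depend on \<open>x\<close>. As the two projections are additive, applying this to the increments of \<open>f\<close>
  bounds every \<open>t\<close>-variation sum by \<open>P + Q\<close> times the variation sum of the same partition.
\<close>

context krein_space
begin

lemma pos_part_in: "pos_part Fp Fm x \<in> Fp"
  and neg_part_in: "neg_part Fp Fm x \<in> Fm"
  and parts_sum: "x = pos_part Fp Fm x + neg_part Fp Fm x"
proof -
  obtain u v where "u \<in> Fp" "v \<in> Fm" "x = u + v" using decomp_sum by blast
  then show "pos_part Fp Fm x \<in> Fp" "neg_part Fp Fm x \<in> Fm"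
      "x = pos_part Fp Fm x + neg_part Fp Fm x"
    by (simp_all add: parts_eqI)
qed

lemma parts_diff:
  "pos_part Fp Fm (x - y) = pos_part Fp Fm x - pos_part Fp Fm y"
  "neg_part Fp Fm (x - y) = neg_part Fp Fm x - neg_part Fp Fm y"
proof -
  have eq: "x - y = (pos_part Fp Fm x - pos_part Fp Fm y) + (neg_part Fp Fm x - neg_part Fp Fm y)"
    unfolding add_diff_add[symmetric] parts_sum[symmetric] ..
  have "pos_part Fp Fm x - pos_part Fp Fm y \<in> Fp" "neg_part Fp Fm x - neg_part Fp Fm y \<in> Fm"
    by (simp_all add: subspace_diff subspace_Fp subspace_Fm pos_part_in neg_part_in)
  note parts_eqI[OF this, folded eq]
  then show "pos_part Fp Fm (x - y) = pos_part Fp Fm x - pos_part Fp Fm y"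
    "neg_part Fp Fm (x - y) = neg_part Fp Fm x - neg_part Fp Fm y" .
qed

lemma parts_fund_sym:
  "pos_part Fp Fm (fund_sym Fp Fm x) = pos_part Fp Fm x"
  "neg_part Fp Fm (fund_sym Fp Fm x) = - neg_part Fp Fm x"
proof -
  have "- neg_part Fp Fm x \<in> Fm"
    by (simp add: subspace_neg subspace_Fm neg_part_in)
  from parts_eqI[OF pos_part_in[of x] this]
  show "pos_part Fp Fm (fund_sym Fp Fm x) = pos_part Fp Fm x"
    "neg_part Fp Fm (fund_sym Fp Fm x) = - neg_part Fp Fm x"
    by (simp_all add: fund_sym_def)
qed

lemma br_minus_left: "br (- x) y = - br x y"
proof -
  have "br (smul (-1) x) y = -1 * br x y"
    using hermitian unfolding hermitian_form_on_def by blast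
  then show ?thesis by (simp add: scale_minus_left)
qed

lemma br_zero_left: "br 0 y = 0"
proof -
  have "br (0 + 0) y = br 0 y + br 0 y"
    using hermitian unfolding hermitian_form_on_def by blast
  then show ?thesis by simp
qed

lemma br_nonneg_Fp: "u \<in> Fp \<Longrightarrow> 0 \<le> Re (br u u)"
  using hilbert_pos unfolding hilbert_on_def by (cases "u = 0") (auto simp: br_zero_left less_imp_le)

lemma br_nonpos_Fm: "v \<in> Fm \<Longrightarrow> Re (br v v) \<le> 0"
  using hilbert_neg unfolding hilbert_on_def by (cases "v = 0") (auto simp: br_zero_left less_imp_le)

lemma norm_pos_nonneg: "0 \<le> norm_pos br (pos_part Fp Fm x)"
  by (simp add: norm_pos_def form_norm_def br_nonneg_Fp pos_part_in)

lemma norm_neg_nonneg: "0 \<le> norm_neg br (neg_part Fp Fm x)"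
  by (simp add: norm_neg_def form_norm_def br_nonpos_Fm neg_part_in)

text \<open>
  The sign that \<open>\<J>\<close> puts on the negative part is what makes both terms of the radicand squares:
  \<open>[- x\<^sup>-, x\<^sup>-] = \<parallel>x\<^sup>-\<parallel>\<^sup>2\<close>.
\<close>

lemma two_norm_eq:
  "two_norm br Fp Fm x t =
     sqrt ((norm_pos br (pos_part Fp Fm x) * norm_pos br (pos_part Fp Fm t))\<^sup>2 +
           (norm_neg br (neg_part Fp Fm x) * norm_neg br (neg_part Fp Fm t))\<^sup>2)"
proof -
  have "Re (br (pos_part Fp Fm x) (pos_part Fp Fm x)) = (norm_pos br (pos_part Fp Fm x))\<^sup>2"
    by (simp add: norm_pos_def form_norm_def br_nonneg_Fp pos_part_in)
  moreover have "Re (br (neg_part Fp Fm x) (neg_part Fp Fm x)) = - (norm_neg br (neg_part Fp Fm x))\<^sup>2"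
    by (simp add: norm_neg_def form_norm_def br_nonpos_Fm neg_part_in)
  ultimately show ?thesis
    by (simp add: two_norm_def std_two_form_def parts_fund_sym br_minus_left power_mult_distrib
        del: of_real_power)
qed

lemma two_norm_le:
  "two_norm br Fp Fm x t \<le>
     (norm_pos br (pos_part Fp Fm t) + norm_neg br (neg_part Fp Fm t)) *
     (norm_pos br (pos_part Fp Fm x) + norm_neg br (neg_part Fp Fm x))"
proof -
  define p q P Q where "p = norm_pos br (pos_part Fp Fm x)" and "q = norm_neg br (neg_part Fp Fm x)"
    and "P = norm_pos br (pos_part Fp Fm t)" and "Q = norm_neg br (neg_part Fp Fm t)"
  have nonneg: "0 \<le> p" "0 \<le> q" "0 \<le> P" "0 \<le> Q"
    by (simp_all add: p_def q_def P_def Q_def norm_pos_nonneg norm_neg_nonneg)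
  have "two_norm br Fp Fm x t = sqrt ((p * P)\<^sup>2 + (q * Q)\<^sup>2)"
    by (simp add: two_norm_eq p_def q_def P_def Q_def)
  also have "\<dots> \<le> p * P + q * Q"
    using nonneg by (intro sqrt_sum_squares_le_sum) simp_all
  also have "\<dots> \<le> (P + Q) * (p + q)"
    using nonneg by (simp add: algebra_simps)
  finally show ?thesis by (simp add: p_def q_def P_def Q_def)
qed

end

theorem proposition5p1:
  fixes smul :: "complex \<Rightarrow> 'a::ab_group_add \<Rightarrow> 'a"
    and br :: "'a \<Rightarrow> 'a \<Rightarrow> complex"
    and Fp Fm :: "'a set"
    and t :: 'a
    and a b :: real
    and f :: "real \<Rightarrow> 'a"
  assumes "krein_space smul br Fp Fm"
    and "a \<le> b"
    and "strongly_bounded_variation br Fp Fm a b f"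
  shows "strongly_bounded_t_variation br Fp Fm t a b f"
proof -
  interpret krein_space smul br Fp Fm by fact
  define C where "C = norm_pos br (pos_part Fp Fm t) + norm_neg br (neg_part Fp Fm t)"
  define step where "step x i =
      norm_pos br (pos_part Fp Fm (f (x i)) - pos_part Fp Fm (f (x (i - 1)))) +
      norm_neg br (neg_part Fp Fm (f (x i)) - neg_part Fp Fm (f (x (i - 1))))"
    for x :: "nat \<Rightarrow> real" and i
  have "0 \<le> C"
    by (simp add: C_def norm_pos_nonneg norm_neg_nonneg)
  obtain M :: real where M: "strong_variation br Fp Fm a b f \<le> ereal M"
    using assms(3) unfolding strongly_bounded_variation_def
    by (cases "strong_variation br Fp Fm a b f") auto
  have "(\<Sum>i=1..n. two_norm br Fp Fm (f (x i) - f (x (i - 1))) t) \<le> C * M"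
    if "(n, x) \<in> partitions a b" for n x
  proof -
    have "ereal (\<Sum>i=1..n. step x i) \<le> strong_variation br Fp Fm a b f"
      unfolding strong_variation_def step_def by (rule SUP_upper2[OF that]) simp
    from order_trans[OF this M] have le_M: "(\<Sum>i=1..n. step x i) \<le> M"
      by simp
    have "(\<Sum>i=1..n. two_norm br Fp Fm (f (x i) - f (x (i - 1))) t) \<le> (\<Sum>i=1..n. C * step x i)"
      using two_norm_le[of _ t] by (intro sum_mono) (simp add: C_def step_def flip: parts_diff)
    also have "\<dots> = C * (\<Sum>i=1..n. step x i)"
      by (simp add: sum_distrib_left)
    also have "\<dots> \<le> C * M"
      using le_M \<open>0 \<le> C\<close> by (rule mult_left_mono)
    finally show ?thesis .
  qed
  then have "strong_t_variation br Fp Fm t a b f \<le> ereal (C * M)"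
    unfolding strong_t_variation_def by (intro SUP_least) auto
  then show ?thesis
    unfolding strongly_bounded_t_variation_def by (rule le_less_trans) simp
qed

end
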